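(* For any non-constant polynomials $M_1,M_2\in\mathbb{F}_q[x]$ which are both relatively prime to $b$, we have: (a) $\alpha([M_1,M_2])=[\alpha(M_1),\alpha(M_2)]$; (b) $\pi([M_1,M_2])=[\pi(M_1),\pi(M_2)]$.
   Context: Let $\mathbb{F}_q$ be a finite field. Fix $a,b\in\mathbb{F}_q[x]$ with $b\neq 0$. The generalized Fibonacci sequence is $F_0=0$, $F_1=1$, $F_n=aF_{n-1}+bF_{n-2}$ for $n\ge 2$. For a non-constant $M\in\mathbb{F}_q[x]$ with $\gcd(b,M)=1$, the rank $\alpha(M)$ is the least positive integer $n$ with $F_n\equiv 0\pmod M$, and the period $\pi(M)$ is the least positive integer $n$ with $F_n\equiv 0$ and $F_{n+1}\equiv 1\pmod M$. For integers, $[m_1,m_2]$ is the least common multiple; for polynomials, $[M_1,M_2]$ is the monic common multiple of $M_1$ and $M_2$ of smallest degree. *)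

theory Defs
  imports "HOL-Computational_Algebra.Polynomial" "HOL-Number_Theory.Cong"
begin

fun gen_fib :: "'a::field poly \<Rightarrow> 'a poly \<Rightarrow> nat \<Rightarrow> 'a poly" where
  "gen_fib a b 0 = 0"
| "gen_fib a b (Suc 0) = 1"
| "gen_fib a b (Suc (Suc n)) = a * gen_fib a b (Suc n) + b * gen_fib a b n"

(* Over a finite field, with M non-constant and coprime to b, the indices minimised
   over below exist; otherwise LEAST may be an unspecified number. *)

definition fib_rank :: "'a::field poly \<Rightarrow> 'a poly \<Rightarrow> 'a poly \<Rightarrow> nat" where
  "fib_rank a b M = (LEAST n. n > 0 \<and> [gen_fib a b n = 0] (mod M))"

definition fib_period :: "'a::field poly \<Rightarrow> 'a poly \<Rightarrow> 'a poly \<Rightarrow> nat" where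
  "fib_period a b M =
     (LEAST n. n > 0 \<and> [gen_fib a b n = 0] (mod M) \<and> [gen_fib a b (Suc n) = 1] (mod M))"

(* The library lcm on polynomials needs a coefficient class with its own gcd operations
   (field_gcd), so it is not available over an arbitrary finite field. The description
   below is unique when both arguments are nonzero. *)
definition monic_lcm :: "'a::field poly \<Rightarrow> 'a poly \<Rightarrow> 'a poly" where
  "monic_lcm M1 M2 =
     (THE L. is_arg_min degree (\<lambda>K. lead_coeff K = 1 \<and> M1 dvd K \<and> M2 dvd K) L)"

end

theory Submission
  imports Defs
begin

text \<open>
  Call \<open>n\<close> a zero of \<open>M\<close> if \<open>M\<close> divides \<open>F\<^sub>n\<close>, and a return of \<open>M\<close> if in addition
  \<open>F\<^sub>n\<^sub>+\<^sub>1\<close> is congruent to \<open>1\<close>. The point is that, when \<open>b\<close> is coprime to \<open>M\<close>, the zeros of \<open>M\<close>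
  are exactly the multiples of its rank and the returns exactly the multiples of its period
  (\<open>dvd_gen_fib_iff\<close> and \<open>return_iff_fib_period_dvd\<close>). Since being divisible by the least common
  multiple \<open>L\<close> means being divisible by both \<open>M\<^sub>1\<close> and \<open>M\<^sub>2\<close>, the zeros of \<open>L\<close> are the
  common zeros of \<open>M\<^sub>1\<close> and \<open>M\<^sub>2\<close>, that is, the common multiples of the two ranks; the least positive
  one is their least common multiple. The same argument applies to the period.

  That the zeros are the multiples of the least positive one follows from the addition formula
  \<open>gen_fib_add\<close>: shifting the index by a zero \<open>m\<close> multiplies the sequence modulo \<open>M\<close> by \<open>F\<^sub>m\<^sub>+\<^sub>1\<close>,
  which can be cancelled. A return shifts the sequence to itself. Positive returns exist because
  there are finitely many residues, so some pair of consecutive terms recurs modulo \<open>M\<close>; as \<open>b\<close>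
  can be cancelled, the recurrence runs backwards to the pair \<open>(F\<^sub>0, F\<^sub>1) = (0, 1)\<close>.
\<close>

section \<open>Divisibility of polynomials over an arbitrary field\<close>

text \<open>
  The multipliers \<open>u\<close> for which \<open>M\<close> divides \<open>u * x\<close> form an ideal containing \<open>b\<close> and \<open>M\<close>. A nonzero
  element of least degree divides both by division with remainder, so it is a unit.
\<close>
lemma coprime_dvd_mult_cancel:
  fixes b M x :: "'a::field poly"
  assumes "b \<noteq> 0" "coprime b M" "M dvd b * x"
  shows "M dvd x"
proof -
  define I where "I = {u. M dvd u * x}"
  have "b \<in> I" "M \<in> I" using assms by (auto simp: I_def)
  obtain d where d: "d \<in> I" "d \<noteq> 0" and
    least: "\<And>e. e \<in> I \<Longrightarrow> e \<noteq> 0 \<Longrightarrow> degree d \<le> degree e"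
    using exists_least_iff[of "\<lambda>n. \<exists>u. u \<in> I \<and> u \<noteq> 0 \<and> degree u = n"] \<open>b \<in> I\<close> \<open>b \<noteq> 0\<close>
    by (metis not_less)
  have "d dvd u" if "u \<in> I" for u
  proof -
    have "(u mod d) * x = u * x - (u div d) * (d * x)"
      by (simp add: minus_div_mult_eq_mod[symmetric] algebra_simps)
    then have "u mod d \<in> I"
      using that d(1) by (auto simp: I_def intro: dvd_diff dvd_mult)
    then have "u mod d = 0"
      using least[of "u mod d"] degree_mod_less[OF d(2), of u] by (metis not_less)
    then show ?thesis by auto
  qed
  then have "is_unit d"
    using \<open>b \<in> I\<close> \<open>M \<in> I\<close> assms(2) coprime_common_divisor by blast
  then show ?thesis
    using d(1) by (simp add: I_def dvd_mult_unit_iff')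
qed

lemma monic_associate_exists:
  fixes p :: "'a::field poly"
  assumes "p \<noteq> 0"
  obtains c where "c \<noteq> 0" "lead_coeff (smult c p) = 1"
  using assms by (intro that[of "inverse (lead_coeff p)"]) auto

lemma monic_dvd_antisym:
  fixes p q :: "'a::field poly"
  assumes "lead_coeff p = 1" "lead_coeff q = 1" "p dvd q" "q dvd p"
  shows "p = q"
proof -
  obtain k where k: "q = p * k" using assms(3) by (rule dvdE)
  have "p \<noteq> 0" "q \<noteq> 0" using assms(1,2) by auto
  then have "degree p = degree q"
    using assms(3,4) by (simp add: dvd_imp_degree_le order_antisym)
  then have "degree k = 0" using k \<open>p \<noteq> 0\<close> \<open>q \<noteq> 0\<close> by (auto simp: degree_mult_eq)
  moreover have "lead_coeff k = 1" using k assms(1,2) by (simp add: lead_coeff_mult)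
  ultimately have "k = 1" by (auto elim: degree_eq_zeroE)
  with k show ?thesis by simp
qed

text \<open>
  The remainder of a common multiple by one of least degree is again a common multiple, so it
  vanishes. This gives both the uniqueness behind the definite description and the universal
  property of the least common multiple.
\<close>
lemma monic_lcm_dvd_iff:
  fixes M1 M2 K :: "'a::field poly"
  assumes "M1 \<noteq> 0" "M2 \<noteq> 0"
  shows "monic_lcm M1 M2 dvd K \<longleftrightarrow> M1 dvd K \<and> M2 dvd K"
proof -
  define C where "C = (\<lambda>K. lead_coeff K = 1 \<and> M1 dvd K \<and> M2 dvd K)"
  define least where "least = is_arg_min degree C"
  have min_dvd: "L dvd N" if L: "least L" and N: "M1 dvd N" "M2 dvd N" for L N
  proof (rule ccontr)
    assume "\<not> L dvd N"
    then have nz: "N mod L \<noteq> 0" by auto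
    have CL: "C L" using L by (auto simp: least_def is_arg_min_def)
    obtain c where c: "c \<noteq> 0" "lead_coeff (smult c (N mod L)) = 1"
      using monic_associate_exists[OF nz] .
    have "C (smult c (N mod L))"
      using CL N c by (auto simp: C_def dvd_mod intro!: dvd_smult)
    then have "degree L \<le> degree (N mod L)"
      using L c(1) by (force simp: least_def is_arg_min_def not_less)
    moreover have "L \<noteq> 0" using CL by (auto simp: C_def)
    ultimately show False using degree_mod_less[of L N] nz by auto
  qed
  have "\<exists>L. C L"
  proof -
    have "M1 * M2 \<noteq> 0" using assms by simp
    then obtain c where "lead_coeff (smult c (M1 * M2)) = 1"
      by (rule monic_associate_exists)
    then have "C (smult c (M1 * M2))" by (auto simp: C_def intro!: dvd_smult)
    then show ?thesis ..
  qed
  then obtain L where L: "least L"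
    unfolding least_def is_arg_min_def
    using exists_least_iff[of "\<lambda>n. \<exists>u. C u \<and> degree u = n"] by metis
  have "L' = L" if "least L'" for L'
    using min_dvd[OF that, of L] min_dvd[OF L, of L'] L that
    by (intro monic_dvd_antisym) (auto simp: least_def is_arg_min_def C_def)
  then have "monic_lcm M1 M2 = L"
    using L unfolding monic_lcm_def least_def C_def by blast
  moreover have "M1 dvd L" "M2 dvd L"
    using L by (auto simp: least_def is_arg_min_def C_def)
  ultimately show ?thesis
    using min_dvd[OF L] by (metis dvd_trans)
qed

lemma finite_poly_degree_less:
  "finite {p :: 'a::{zero, finite} poly. degree p < n}"
proof (rule inj_on_finite)
  let ?f = "\<lambda>p :: 'a poly. map (coeff p) [0..<n]"
  show "inj_on ?f {p. degree p < n}"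
  proof (intro inj_onI poly_eqI)
    fix p q :: "'a poly" and i
    assume pq: "p \<in> {p. degree p < n}" "q \<in> {p. degree p < n}" "?f p = ?f q"
    show "coeff p i = coeff q i"
    proof (cases "i < n")
      case True
      then show ?thesis using pq(3) by auto
    next
      case False
      then show ?thesis using pq(1,2) by (simp add: coeff_eq_0)
    qed
  qed
  show "?f ` {p. degree p < n} \<subseteq> {xs. set xs \<subseteq> UNIV \<and> length xs = n}" by auto
  show "finite {xs :: 'a list. set xs \<subseteq> UNIV \<and> length xs = n}"
    by (rule finite_lists_length_eq) simp
qed

section \<open>Least positive elements of shift-invariant sets of indices\<close>

text \<open>
  Invariance of \<open>P\<close> under shifts by its own elements lets every index be reduced modulo the least
  positive one, as for subgroups of the integers.
\<close>
lemma shift_invariant_iff_Least_dvd: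
  fixes P :: "nat \<Rightarrow> bool"
  assumes "P 0" and ex: "\<exists>n>0. P n"
    and shift: "\<And>m n. P m \<Longrightarrow> P (n + m) \<longleftrightarrow> P n"
  shows "P n \<longleftrightarrow> (LEAST n. n > 0 \<and> P n) dvd n" and "(LEAST n. n > 0 \<and> P n) > 0"
proof -
  define d where "d = (LEAST n. n > 0 \<and> P n)"
  have d: "d > 0" "P d"
    using LeastI_ex[of "\<lambda>n. n > 0 \<and> P n"] ex by (auto simp: d_def)
  have mult: "P (k * d)" for k
  proof (induction k)
    case 0
    then show ?case using \<open>P 0\<close> by simp
  next
    case (Suc k)
    then show ?case using shift[OF d(2), of "k * d"] by (simp add: add.commute)
  qed
  have "P n \<longleftrightarrow> P (n mod d)"
    using shift[OF mult, of "n mod d" "n div d"] by simp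
  also have "\<dots> \<longleftrightarrow> n mod d = 0"
    using not_less_Least[of "n mod d" "\<lambda>n. n > 0 \<and> P n"] d(1) \<open>P 0\<close>
    by (auto simp: d_def[symmetric])
  finally show "P n \<longleftrightarrow> (LEAST n. n > 0 \<and> P n) dvd n"
    by (simp add: d_def dvd_eq_mod_eq_0)
  show "(LEAST n. n > 0 \<and> P n) > 0" using d(1) by (simp add: d_def)
qed

lemma Least_pos_common_multiple:
  fixes k l :: nat
  assumes "k > 0" "l > 0"
  shows "(LEAST n. n > 0 \<and> k dvd n \<and> l dvd n) = lcm k l"
  using assms by (intro Least_equality) (auto simp: lcm_pos_nat intro: dvd_imp_le lcm_least)

section \<open>Zeros and returns of the Fibonacci sequence modulo a polynomial\<close>

lemma gen_fib_add:
  "gen_fib a b (Suc (m + n)) =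
     gen_fib a b (Suc m) * gen_fib a b (Suc n) + b * gen_fib a b m * gen_fib a b n"
proof (induction m arbitrary: n)
  case 0
  then show ?case by simp
next
  case (Suc m)
  then show ?case using Suc.IH[of "Suc n"] by (simp add: algebra_simps)
qed

text \<open>
  Consecutive terms have no common factor with \<open>M\<close>, in the form of a cancellation law: the recurrence
  is followed downwards to \<open>F\<^sub>1 = 1\<close>.
\<close>
lemma dvd_consecutive_gen_fib_cancel:
  fixes a b M x :: "'a::field poly"
  assumes "b \<noteq> 0" "coprime b M"
    and "M dvd x * gen_fib a b n" "M dvd x * gen_fib a b (Suc n)"
  shows "M dvd x"
  using assms(3,4)
proof (induction n)
  case 0
  then show ?case by simp
next
  case (Suc n)
  have "b * (x * gen_fib a b n) = x * gen_fib a b (Suc (Suc n)) - a * (x * gen_fib a b (Suc n))"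
    by (simp add: algebra_simps)
  then have "M dvd b * (x * gen_fib a b n)"
    using Suc.prems by (simp only:) (rule dvd_diff, auto intro: dvd_mult)
  then have "M dvd x * gen_fib a b n"
    using coprime_dvd_mult_cancel assms(1,2) by blast
  with Suc show ?case by blast
qed

lemma gen_fib_shift_cong:
  assumes "M dvd gen_fib a b m"
  shows "[gen_fib a b (n + m) = gen_fib a b n * gen_fib a b (Suc m)] (mod M)"
proof (cases n)
  case 0
  then show ?thesis using assms by (simp add: cong_0_iff)
next
  case (Suc k)
  then show ?thesis
    using assms by (simp add: cong_iff_dvd_diff gen_fib_add)
qed

lemma zero_shift_iff:
  fixes a b M :: "'a::field poly"
  assumes "b \<noteq> 0" "coprime b M" and m: "M dvd gen_fib a b m"
  shows "M dvd gen_fib a b (n + m) \<longleftrightarrow> M dvd gen_fib a b n"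
proof -
  have "M dvd gen_fib a b (n + m) \<longleftrightarrow> M dvd gen_fib a b n * gen_fib a b (Suc m)"
    using gen_fib_shift_cong[OF m] by (rule cong_dvd_iff)
  also have "\<dots> \<longleftrightarrow> M dvd gen_fib a b n"
    using dvd_consecutive_gen_fib_cancel[OF assms(1,2), of "gen_fib a b n" a m] m by auto
  finally show ?thesis .
qed

definition is_return :: "'a::field poly \<Rightarrow> 'a poly \<Rightarrow> 'a poly \<Rightarrow> nat \<Rightarrow> bool" where
  "is_return a b M n \<longleftrightarrow> M dvd gen_fib a b n \<and> M dvd gen_fib a b (Suc n) - 1"

lemma return_shift_iff:
  assumes "is_return a b M m"
  shows "is_return a b M (n + m) \<longleftrightarrow> is_return a b M n"
proof -
  have "[gen_fib a b (Suc m) = 1] (mod M)"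
    using assms by (simp add: is_return_def cong_iff_dvd_diff)
  then have shift: "[gen_fib a b (k + m) = gen_fib a b k] (mod M)" for k
    using assms gen_fib_shift_cong[of M a b m k] cong_mult[OF cong_refl[of "gen_fib a b k"]]
    by (metis cong_trans is_return_def mult.right_neutral)
  have "M dvd gen_fib a b (n + m) \<longleftrightarrow> M dvd gen_fib a b n"
    using shift by (rule cong_dvd_iff)
  moreover have "M dvd gen_fib a b (Suc n + m) - 1 \<longleftrightarrow> M dvd gen_fib a b (Suc n) - 1"
    using shift[of "Suc n"] by (intro cong_dvd_iff cong_diff cong_refl)
  ultimately show ?thesis by (simp add: is_return_def)
qed

text \<open>
  The recurrence can be run backwards modulo \<open>M\<close>, since \<open>b\<close> can be cancelled, so a recurring pair of
  consecutive terms leads back to a recurrence of the initial pair.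
\<close>
lemma return_of_recurring_pair:
  fixes a b M :: "'a::field poly"
  assumes "b \<noteq> 0" "coprime b M"
    and "M dvd gen_fib a b (i + n) - gen_fib a b i"
    and "M dvd gen_fib a b (Suc (i + n)) - gen_fib a b (Suc i)"
  shows "is_return a b M n"
  using assms(3,4)
proof (induction i)
  case 0
  then show ?case by (simp add: is_return_def)
next
  case (Suc i)
  let ?D = "\<lambda>i. gen_fib a b (i + n) - gen_fib a b i"
  have "b * ?D i = ?D (Suc (Suc i)) - a * ?D (Suc i)"
    by (simp add: algebra_simps)
  then have "M dvd b * ?D i"
    using Suc.prems by (simp only:) (rule dvd_diff, auto intro: dvd_mult)
  then have "M dvd ?D i"
    using coprime_dvd_mult_cancel assms(1,2) by blast
  with Suc show ?case by simp
qed

lemma exists_pos_return: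
  fixes a b M :: "'a::{field, finite} poly"
  assumes "b \<noteq> 0" "coprime b M" "degree M > 0"
  shows "\<exists>n>0. is_return a b M n"
proof -
  let ?R = "{p :: 'a poly. degree p < degree M}"
  let ?f = "\<lambda>n. (gen_fib a b n mod M, gen_fib a b (Suc n) mod M)"
  have "degree (p mod M) < degree M" for p
    using degree_mod_less[of M p] assms(3) by (metis degree_0 less_numeral_extra(3))
  then have "range ?f \<subseteq> ?R \<times> ?R" by auto
  then have "finite (range ?f)"
    by (rule finite_subset) (simp add: finite_poly_degree_less)
  then have "\<not> inj ?f" using finite_imageD infinite_UNIV_nat by blast
  then obtain i j where ij: "i < j" "?f j = ?f i"
    unfolding inj_def by (metis linorder_neqE_nat)
  then have "is_return a b M (j - i)"
    by (intro return_of_recurring_pair[OF assms(1,2), of a i]) (auto simp: mod_eq_dvd_iff)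
  with ij(1) show ?thesis by (intro exI[of _ "j - i"]) auto
qed

section \<open>Rank and period as divisibility conditions\<close>

lemma fib_rank_eq_Least: "fib_rank a b M = (LEAST n. n > 0 \<and> M dvd gen_fib a b n)"
  by (simp add: fib_rank_def cong_0_iff)

lemma fib_period_eq_Least: "fib_period a b M = (LEAST n. n > 0 \<and> is_return a b M n)"
  by (simp add: fib_period_def is_return_def cong_iff_dvd_diff)

lemma dvd_gen_fib_iff:
  fixes a b M :: "'a::{field, finite} poly"
  assumes "b \<noteq> 0" "coprime b M" "degree M > 0"
  shows "M dvd gen_fib a b n \<longleftrightarrow> fib_rank a b M dvd n" and "fib_rank a b M > 0"
proof -
  have "\<exists>n>0. M dvd gen_fib a b n"
    using exists_pos_return[OF assms] by (auto simp: is_return_def)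
  note least = shift_invariant_iff_Least_dvd[where P = "\<lambda>n. M dvd gen_fib a b n",
      OF _ this zero_shift_iff[OF assms(1,2)]]
  show "M dvd gen_fib a b n \<longleftrightarrow> fib_rank a b M dvd n"
    unfolding fib_rank_eq_Least by (rule least(1)) simp_all
  show "fib_rank a b M > 0"
    unfolding fib_rank_eq_Least by (rule least(2)) simp_all
qed

lemma return_iff_fib_period_dvd:
  fixes a b M :: "'a::{field, finite} poly"
  assumes "b \<noteq> 0" "coprime b M" "degree M > 0"
  shows "is_return a b M n \<longleftrightarrow> fib_period a b M dvd n" and "fib_period a b M > 0"
proof -
  note least = shift_invariant_iff_Least_dvd[where P = "is_return a b M",
      OF _ exists_pos_return[OF assms] return_shift_iff]
  show "is_return a b M n \<longleftrightarrow> fib_period a b M dvd n"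
    unfolding fib_period_eq_Least by (rule least(1)) (simp_all add: is_return_def)
  show "fib_period a b M > 0"
    unfolding fib_period_eq_Least by (rule least(2)) (simp_all add: is_return_def)
qed

theorem theorem3p1:
  fixes a b M1 M2 :: "'a::{field, finite} poly"
  assumes "b \<noteq> 0"
    and "degree M1 > 0" and "degree M2 > 0"
    and "coprime b M1" and "coprime b M2"
  shows "fib_rank a b (monic_lcm M1 M2) = lcm (fib_rank a b M1) (fib_rank a b M2)
      \<and> fib_period a b (monic_lcm M1 M2) = lcm (fib_period a b M1) (fib_period a b M2)"
proof
  have "M1 \<noteq> 0" "M2 \<noteq> 0" using assms(2,3) by auto
  note L = monic_lcm_dvd_iff[OF this]
  note rank = dvd_gen_fib_iff[OF assms(1,4,2)] dvd_gen_fib_iff[OF assms(1,5,3)]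
  note period = return_iff_fib_period_dvd[OF assms(1,4,2)]
    return_iff_fib_period_dvd[OF assms(1,5,3)]
  show "fib_rank a b (monic_lcm M1 M2) = lcm (fib_rank a b M1) (fib_rank a b M2)"
    unfolding fib_rank_eq_Least[of a b "monic_lcm M1 M2"] L rank(1,3)
    by (rule Least_pos_common_multiple[OF rank(2,4)])
  have "is_return a b (monic_lcm M1 M2) n \<longleftrightarrow> is_return a b M1 n \<and> is_return a b M2 n" for n
    by (auto simp: is_return_def L)
  then show "fib_period a b (monic_lcm M1 M2) = lcm (fib_period a b M1) (fib_period a b M2)"
    unfolding fib_period_eq_Least[of a b "monic_lcm M1 M2"]
    by (simp add: period(1,3) Least_pos_common_multiple[OF period(2,4)])
qed

end
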